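(* Let $n\ge0$ be an integer. Let $K$ be the complete graph on the vertices $\{\sigma,\rho,2\rho,2^2\rho,\dots,2^n\rho\}$ considered as a directed graph, with edges labelled by elements of $A_{C_2}^\vee(n)$ as in the context. I. For $i\ge1$, $j\ge0$ with $i+j\le n$, the coproduct $\psi(\xi_i^{2^j})\in A_{C_2}^\vee(n)\otimes_{\mathbb{M}_2}A_{C_2}^\vee(n)$ is the sum of tensors of all pairs of edges that make length $2$ directed paths (degenerate paths included) from the vertex $2^j\rho$ to the vertex $2^{i+j}\rho$ in $K$. II. Similarly, for $0\le i\le n$, the coproduct $\psi(\tau_i)$ is the sum of tensors of all pairs of edges that make length $2$ directed paths (degenerate paths included) from the vertex $\sigma$ to the vertex $2^i\rho$ in $K$. Here the tensor of a pair of consecutive edges $v\xrightarrow{e}w\xrightarrow{e'}z$ is (label of $e'$)$\,\otimes\,$(label of $e$).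
   Context: Let $\mathbb{M}_2=\mathbb{F}_2[a,u]\oplus\frac{\mathbb{F}_2[a,u]}{(a^\infty,u^\infty)}\{\theta\}$ be the bigraded coefficient ring ($RO(C_2)$-graded homology of a point with coefficients in the constant Mackey functor $\underline{\mathbb{F}}_2$), $|a|=(-1,-1)$, $|u|=(0,-1)$. Let $A_{C_2}^\vee(n)=\mathbb{M}_2[\xi_1,\dots,\xi_n,\tau_0,\dots,\tau_n]/(\xi_i^{2^{n-i+1}},\ \tau_i^2=(u+a\tau_0)\xi_{i+1}+a\tau_{i+1})$ with $\xi_{n+1}=\tau_{n+1}=0$, a quotient of the $C_2$-equivariant dual Steenrod algebra, with Hopf algebroid structure over $\mathbb{M}_2$ inherited from the latter. The tensor product over $\mathbb{M}_2$ uses the right unit on the left factor and the left unit on the right factor. The coproduct is the ring homomorphism with $\psi(\xi_m)=\sum_{k=0}^m\xi_{m-k}^{2^k}\otimes\xi_k$ and $\psi(\tau_m)=\tau_m\otimes1+\sum_{k=0}^m\xi_{m-k}^{2^k}\otimes\tau_k$, where $\xi_0=1$. Here $\sigma$ is the sign representation and $\rho=1+\sigma$ the regular representation of $C_2$; the vertices of $K$ are $n+2$ distinct symbols. Every edge of $K$ is directed towards the later vertex in the order $\sigma,\rho,2\rho,\dots,2^n\rho$; the edge $2^a\rho\to2^b\rho$ ($a<b$) is labelled $\xi_{b-a}^{2^a}$ and the edge $\sigma\to2^a\rho$ is labelled $\tau_a$. Degenerate length $2$ paths from $v$ to $z$ are those consisting of the edge $v\to z$ together with a loop at $v$ (traversed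 before the edge) or a loop at $z$ (traversed after the edge); a loop is labelled $1$. *)

theory Defs
  imports
    "HOL-Library.Poly_Mapping"
    "HOL-Library.Product_Plus"
    "HOL-Library.Z2"
    "HOL-Algebra.Algebraic_Closure_Type"
    "HOL-Algebra.QuotRing"
    "Graph_Theory.Pair_Digraph"
begin

section \<open>The coefficient ring\<close>

text \<open>
  An element of the coefficient ring is a pair of finitely supported families of scalars in
  the field with two elements. The coefficient of \<open>(i, j)\<close> in \<open>pos_part\<close> belongs to
  \<open>a\<^sup>i u\<^sup>j\<close>; the coefficient of \<open>(i, j)\<close> in \<open>neg_part\<close> belongs to \<open>\<theta> / (a\<^sup>i u\<^sup>j)\<close>
  with \<open>i, j \<ge> 0\<close>, where \<open>\<theta>\<close> is normalised as the socle generator, i.e.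
  \<open>a \<theta> = u \<theta> = 0\<close>. The elements of the second summand multiply to zero among themselves.
\<close>

datatype m2 = M2 (pos_part: "(nat \<times> nat) \<Rightarrow>\<^sub>0 bit") (neg_part: "(nat \<times> nat) \<Rightarrow>\<^sub>0 bit")

definition neg_act :: "((nat \<times> nat) \<Rightarrow>\<^sub>0 bit) \<Rightarrow> ((nat \<times> nat) \<Rightarrow>\<^sub>0 bit) \<Rightarrow> ((nat \<times> nat) \<Rightarrow>\<^sub>0 bit)"
  where "neg_act p x =
    (\<Sum>(i, j)\<in>Poly_Mapping.keys p. \<Sum>(k, l)\<in>Poly_Mapping.keys x.
       if i \<le> k \<and> j \<le> l
       then Poly_Mapping.single (k - i, l - j)
              (Poly_Mapping.lookup p (i, j) * Poly_Mapping.lookup x (k, l)) else 0)"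

lemma neg_act_superset:
  assumes "finite S" "Poly_Mapping.keys p \<subseteq> S" "finite T" "Poly_Mapping.keys x \<subseteq> T"
  shows "neg_act p x = (\<Sum>s\<in>S. \<Sum>t\<in>T.
       if fst s \<le> fst t \<and> snd s \<le> snd t
       then Poly_Mapping.single (fst t - fst s, snd t - snd s)
              (Poly_Mapping.lookup p s * Poly_Mapping.lookup x t) else 0)"
    (is "_ = (\<Sum>s\<in>S. \<Sum>t\<in>T. ?f s t)")
proof -
  have "neg_act p x = (\<Sum>s\<in>Poly_Mapping.keys p. \<Sum>t\<in>Poly_Mapping.keys x. ?f s t)"
    by (simp only: neg_act_def case_prod_unfold prod.collapse)
  also have "\<dots> = (\<Sum>s\<in>Poly_Mapping.keys p. \<Sum>t\<in>T. ?f s t)"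
    by (intro sum.cong refl sum.mono_neutral_left assms) (simp add: in_keys_iff)
  also have "\<dots> = (\<Sum>s\<in>S. \<Sum>t\<in>T. ?f s t)"
    by (intro sum.mono_neutral_left assms ballI sum.neutral) (simp add: in_keys_iff)
  finally show ?thesis .
qed

lemma if_single_add:
  "(if c then Poly_Mapping.single m (v + w) else 0) =
     (if c then Poly_Mapping.single m v else 0) + (if c then Poly_Mapping.single m w else 0)"
  by (simp add: single_add)

lemma neg_act_add_left: "neg_act (p + q) x = neg_act p x + neg_act q x"
proof -
  let ?S = "Poly_Mapping.keys p \<union> Poly_Mapping.keys q"
  have f: "finite ?S" "finite (Poly_Mapping.keys x)" by simp_all
  show ?thesis
    unfolding neg_act_superset[OF f(1) keys_add f(2) order_refl]
      neg_act_superset[OF f(1) Un_upper1 f(2) order_refl]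
      neg_act_superset[OF f(1) Un_upper2 f(2) order_refl] sum.distrib[symmetric]
    by (intro sum.cong refl) (simp only: lookup_add distrib_right if_single_add)
qed

lemma neg_act_add_right: "neg_act p (x + y) = neg_act p x + neg_act p y"
proof -
  let ?S = "Poly_Mapping.keys x \<union> Poly_Mapping.keys y"
  have f: "finite ?S" "finite (Poly_Mapping.keys p)" by simp_all
  show ?thesis
    unfolding neg_act_superset[OF f(2) order_refl f(1) keys_add]
      neg_act_superset[OF f(2) order_refl f(1) Un_upper1]
      neg_act_superset[OF f(2) order_refl f(1) Un_upper2] sum.distrib[symmetric]
    by (intro sum.cong refl) (simp only: lookup_add distrib_left if_single_add)
qed

lemma neg_act_single:
  "neg_act (Poly_Mapping.single (i, j) b) (Poly_Mapping.single (k, l) c) =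
    (if i \<le> k \<and> j \<le> l then Poly_Mapping.single (k - i, l - j) (b * c) else 0)"
  by (subst neg_act_superset[of "{(i, j)}" _ "{(k, l)}"]) auto

lemma neg_act_0 [simp]: "neg_act 0 x = 0" "neg_act p 0 = 0"
  by (simp_all add: neg_act_def)

lemma poly_mapping_add_induct [case_names zero single add]:
  fixes p :: "'a \<Rightarrow>\<^sub>0 'b::comm_monoid_add"
  assumes "P 0" "\<And>k v. P (Poly_Mapping.single k v)" "\<And>p q. P p \<Longrightarrow> P q \<Longrightarrow> P (p + q)"
  shows "P p"
proof (induction p rule: update_induct)
  case const
  show ?case by (rule assms(1))
next
  case (update p k v)
  have "Poly_Mapping.update k v p = p + Poly_Mapping.single k v"
    using update.hyps
    by (auto intro!: poly_mapping_eqI simp: lookup_update lookup_add lookup_single in_keys_iff when_def)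
  then show ?case using assms update by metis
qed

lemma neg_act_1: "neg_act 1 x = x"
proof (induction x rule: poly_mapping_add_induct)
  case (single k v)
  then show ?case
    using neg_act_single[of 0 0 1 "fst k" "snd k" v]
    by (simp add: zero_prod_def flip: single_one)
next
  case (add p q)
  then show ?case by (simp add: neg_act_add_right)
qed simp

lemma neg_act_mult: "neg_act (p * q) x = neg_act p (neg_act q x)"
proof (induction x rule: poly_mapping_add_induct)
  case (single k v)
  show ?case
  proof (induction p rule: poly_mapping_add_induct)
    case (single s b)
    show ?case
    proof (induction q rule: poly_mapping_add_induct)
      case (single t c)
      show ?case
        by (cases s; cases t; cases k)
          (auto simp: mult_single neg_act_single mult.assoc add.commute)
    qed (simp_all add: distrib_left neg_act_add_left neg_act_add_right)
  qed (simp_all add: distrib_right neg_act_add_left)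
qed (simp_all add: neg_act_add_right)

instantiation m2 :: comm_ring_1
begin

definition "0 = M2 0 0"
definition "1 = M2 1 0"
definition "x + y = M2 (pos_part x + pos_part y) (neg_part x + neg_part y)"
definition "x - y = M2 (pos_part x - pos_part y) (neg_part x - neg_part y)"
definition "- x = M2 (- pos_part x) (- neg_part x)"
definition "x * y = M2 (pos_part x * pos_part y)
                       (neg_act (pos_part x) (neg_part y) + neg_act (pos_part y) (neg_part x))"

instance
proof
  fix x y z :: m2
  note defs = zero_m2_def one_m2_def plus_m2_def minus_m2_def uminus_m2_def times_m2_def
  show "x * y * z = x * (y * z)"
    by (simp add: defs neg_act_add_right add.assoc mult.assoc
        neg_act_mult[symmetric] mult.commute)
  show "x * y = y * x" by (simp add: defs mult.commute add.commute)
  show "1 * x = x" by (simp add: defs neg_act_1)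
  show "(x + y) * z = x * z + y * z"
    by (simp add: defs distrib_right neg_act_add_left neg_act_add_right add.assoc
        add.left_commute)
  show "x + y + z = x + (y + z)" by (simp add: defs add.assoc)
  show "x + y = y + x" by (simp add: defs add.commute)
  show "0 + x = x" by (simp add: defs)
  show "- x + x = 0" by (simp add: defs)
  show "x - y = x + - y" by (simp add: defs)
  show "(0 :: m2) \<noteq> 1" by (simp add: defs)
qed

end

definition m2_a :: m2 where "m2_a = M2 (Poly_Mapping.single (1, 0) 1) 0"
definition m2_u :: m2 where "m2_u = M2 (Poly_Mapping.single (0, 1) 1) 0"

text \<open>\<open>m2_theta i j\<close> is \<open>\<theta> / (a\<^sup>i u\<^sup>j)\<close>.\<close>
definition m2_theta :: "nat \<Rightarrow> nat \<Rightarrow> m2" where "m2_theta i j = M2 0 (Poly_Mapping.single (i, j) 1)"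


section \<open>The quotient of the dual Steenrod algebra\<close>

datatype gen = Xi nat | Tau nat

type_synonym 'v mpoly_m2 = "('v \<Rightarrow>\<^sub>0 nat) \<Rightarrow>\<^sub>0 m2"

definition Const :: "m2 \<Rightarrow> 'v mpoly_m2" where "Const c = Poly_Mapping.single 0 c"
definition Var :: "'v \<Rightarrow> 'v mpoly_m2" where "Var v = Poly_Mapping.single (Poly_Mapping.single v 1) 1"

definition gens :: "nat \<Rightarrow> gen set" where "gens n = Xi ` {1..n} \<union> Tau ` {0..n}"

definition gen_poly_ring :: "nat \<Rightarrow> gen mpoly_m2 ring" where
  "gen_poly_ring n = ring_of_type_algebra
     \<lparr>carrier := {p. \<forall>m\<in>Poly_Mapping.keys p. Poly_Mapping.keys m \<subseteq> gens n}\<rparr>"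

text \<open>The conventions are \<open>\<xi>\<^sub>0 = 1\<close> and \<open>\<xi>\<^sub>m = \<tau>\<^sub>m = 0\<close> for \<open>m > n\<close>.\<close>

definition xi_poly :: "nat \<Rightarrow> nat \<Rightarrow> gen mpoly_m2" where
  "xi_poly n i = (if i = 0 then 1 else if i \<le> n then Var (Xi i) else 0)"

definition tau_poly :: "nat \<Rightarrow> nat \<Rightarrow> gen mpoly_m2" where
  "tau_poly n i = (if i \<le> n then Var (Tau i) else 0)"

definition relators :: "nat \<Rightarrow> gen mpoly_m2 set" where
  "relators n =
     {xi_poly n i ^ 2 ^ (n - i + 1) | i. 1 \<le> i \<and> i \<le> n} \<union>
     {tau_poly n i ^ 2 -
        ((Const m2_u + Const m2_a * tau_poly n 0) * xi_poly n (i + 1)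
          + Const m2_a * tau_poly n (i + 1)) | i. i \<le> n}"

definition rel_ideal :: "nat \<Rightarrow> gen mpoly_m2 set" where
  "rel_ideal n = Idl\<^bsub>gen_poly_ring n\<^esub> (relators n)"

definition A :: "nat \<Rightarrow> gen mpoly_m2 set ring" where
  "A n = gen_poly_ring n Quot rel_ideal n"

definition cls :: "nat \<Rightarrow> gen mpoly_m2 \<Rightarrow> gen mpoly_m2 set" where
  "cls n p = rel_ideal n +>\<^bsub>gen_poly_ring n\<^esub> p"

definition xi :: "nat \<Rightarrow> nat \<Rightarrow> gen mpoly_m2 set" where "xi n i = cls n (xi_poly n i)"
definition tau :: "nat \<Rightarrow> nat \<Rightarrow> gen mpoly_m2 set" where "tau n i = cls n (tau_poly n i)"

definition left_unit :: "nat \<Rightarrow> m2 \<Rightarrow> gen mpoly_m2 set" where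
  "left_unit n m = cls n (Const m)"

text \<open>
  The right unit is the ring homomorphism fixing \<open>a\<close> and sending \<open>u\<close> to \<open>u + a \<tau>\<^sub>0\<close>.
  On the second summand it is given by expanding \<open>(u + a \<tau>\<^sub>0)\<^sup>-\<^sup>1\<close> in powers of
  \<open>a \<tau>\<^sub>0 / u\<close>. Since \<open>\<theta> / (a\<^sup>i u\<^sup>j)\<close> stands for the class of
  \<open>1 / (a^(i+1) u^(j+1))\<close>, this sends \<open>\<theta> / (a^i u^j)\<close> to the sum over \<open>k \<le> i\<close> of
  \<open>(j + k choose k) \<theta> / (a^(i-k) u^(j+k)) \<tau>\<^sub>0^k\<close>, signs being irrelevant modulo 2.
\<close>

definition right_unit_poly :: "nat \<Rightarrow> m2 \<Rightarrow> gen mpoly_m2" where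
  "right_unit_poly n m =
     (\<Sum>(i, j)\<in>Poly_Mapping.keys (pos_part m).
        Const m2_a ^ i * (Const m2_u + Const m2_a * tau_poly n 0) ^ j) +
     (\<Sum>(i, j)\<in>Poly_Mapping.keys (neg_part m). \<Sum>k\<le>i.
        Const (of_nat ((j + k) choose k) * m2_theta (i - k) (j + k)) * tau_poly n 0 ^ k)"

definition right_unit :: "nat \<Rightarrow> m2 \<Rightarrow> gen mpoly_m2 set" where
  "right_unit n m = cls n (right_unit_poly n m)"


section \<open>Tensor products of commutative algebras\<close>

text \<open>
  The free abelian group on \<open>carrier R \<times> carrier S\<close>, with the multiplication
  \<open>(x, y) (x', y') = (x x', y y')\<close> extended bilinearly.
\<close>

definition tensor_base :: "('a, 'c) ring_scheme \<Rightarrow> ('b, 'd) ring_scheme \<Rightarrow> (('a \<times> 'b) \<Rightarrow>\<^sub>0 int) ring"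
  where "tensor_base R S =
    \<lparr>carrier = {p. Poly_Mapping.keys p \<subseteq> carrier R \<times> carrier S},
     monoid.mult = (\<lambda>p q. frag_extend (\<lambda>(x, y).
                frag_extend (\<lambda>(x', y'). frag_of (x \<otimes>\<^bsub>R\<^esub> x', y \<otimes>\<^bsub>S\<^esub> y')) q) p),
     monoid.one = frag_of (\<one>\<^bsub>R\<^esub>, \<one>\<^bsub>S\<^esub>),
     ring.zero = 0,
     ring.add = (+)\<rparr>"

text \<open>
  The tensor product over a ring \<open>M\<close> of \<open>R\<close>, a right \<open>M\<close>-module via \<open>f\<close>, and \<open>S\<close>, a left
  \<open>M\<close>-module via \<open>g\<close>. The subgroup generated by the relations below is already an ideal.
\<close>

definition tensor_relators ::
    "('m \<Rightarrow> 'a) \<Rightarrow> ('m \<Rightarrow> 'b) \<Rightarrow> ('a, 'c) ring_scheme \<Rightarrow> ('b, 'd) ring_scheme \<Rightarrow> (('a \<times> 'b) \<Rightarrow>\<^sub>0 int) set"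
  where "tensor_relators f g R S =
     {frag_of (x \<oplus>\<^bsub>R\<^esub> x', y) - (frag_of (x, y) + frag_of (x', y)) | x x' y.
        x \<in> carrier R \<and> x' \<in> carrier R \<and> y \<in> carrier S} \<union>
     {frag_of (x, y \<oplus>\<^bsub>S\<^esub> y') - (frag_of (x, y) + frag_of (x, y')) | x y y'.
        x \<in> carrier R \<and> y \<in> carrier S \<and> y' \<in> carrier S} \<union>
     {frag_of (x \<otimes>\<^bsub>R\<^esub> f m, y) - frag_of (x, g m \<otimes>\<^bsub>S\<^esub> y) | x m y.
        x \<in> carrier R \<and> y \<in> carrier S}"

definition tensor_ideal ::
    "('m \<Rightarrow> 'a) \<Rightarrow> ('m \<Rightarrow> 'b) \<Rightarrow> ('a, 'c) ring_scheme \<Rightarrow> ('b, 'd) ring_scheme \<Rightarrow> (('a \<times> 'b) \<Rightarrow>\<^sub>0 int) set"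
  where "tensor_ideal f g R S = Idl\<^bsub>tensor_base R S\<^esub> (tensor_relators f g R S)"

definition tensor_ring ::
    "('m \<Rightarrow> 'a) \<Rightarrow> ('m \<Rightarrow> 'b) \<Rightarrow> ('a, 'c) ring_scheme \<Rightarrow> ('b, 'd) ring_scheme \<Rightarrow>
      (('a \<times> 'b) \<Rightarrow>\<^sub>0 int) set ring"
  where "tensor_ring f g R S = tensor_base R S Quot tensor_ideal f g R S"

definition AA :: "nat \<Rightarrow> ((gen mpoly_m2 set \<times> gen mpoly_m2 set) \<Rightarrow>\<^sub>0 int) set ring" where
  "AA n = tensor_ring (right_unit n) (left_unit n) (A n) (A n)"

definition tensor :: "gen mpoly_m2 set \<Rightarrow> nat \<Rightarrow> gen mpoly_m2 set \<Rightarrow>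
    ((gen mpoly_m2 set \<times> gen mpoly_m2 set) \<Rightarrow>\<^sub>0 int) set"
    (\<open>(_ \<otimes>\<otimes>\<^bsub>_\<^esub> _)\<close> [71, 0, 71] 70) where
  "x \<otimes>\<otimes>\<^bsub>n\<^esub> y =
     tensor_ideal (right_unit n) (left_unit n) (A n) (A n) +>\<^bsub>tensor_base (A n) (A n)\<^esub> frag_of (x, y)"


section \<open>The coproduct\<close>

text \<open>
  These conditions determine \<open>\<psi>\<close> uniquely on the carrier, because the image of the left unit
  together with the elements \<open>\<xi>\<^sub>m\<close> and \<open>\<tau>\<^sub>m\<close> generates \<open>A n\<close> as a ring.
\<close>

definition is_coproduct :: "nat \<Rightarrow>
    (gen mpoly_m2 set \<Rightarrow> ((gen mpoly_m2 set \<times> gen mpoly_m2 set) \<Rightarrow>\<^sub>0 int) set) \<Rightarrow> bool" where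
  "is_coproduct n \<psi> \<longleftrightarrow>
     \<psi> \<in> ring_hom (A n) (AA n) \<and>
     (\<forall>c. \<psi> (left_unit n c) = left_unit n c \<otimes>\<otimes>\<^bsub>n\<^esub> \<one>\<^bsub>A n\<^esub>) \<and>
     (\<forall>m\<in>{1..n}. \<psi> (xi n m) =
        (\<Oplus>\<^bsub>AA n\<^esub>k\<in>{0..m}. (xi n (m - k) [^]\<^bsub>A n\<^esub> (2 ^ k :: nat)) \<otimes>\<otimes>\<^bsub>n\<^esub> xi n k)) \<and>
     (\<forall>m\<in>{0..n}. \<psi> (tau n m) =
        (tau n m \<otimes>\<otimes>\<^bsub>n\<^esub> \<one>\<^bsub>A n\<^esub>) \<oplus>\<^bsub>AA n\<^esub>
        (\<Oplus>\<^bsub>AA n\<^esub>k\<in>{0..m}. (xi n (m - k) [^]\<^bsub>A n\<^esub> (2 ^ k :: nat)) \<otimes>\<otimes>\<^bsub>n\<^esub> tau n k))"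


section \<open>The labelled graph\<close>

text \<open>\<open>Rho a\<close> is the vertex \<open>2\<^sup>a \<rho>\<close>.\<close>
datatype vertex = Sigma | Rho nat

fun position :: "vertex \<Rightarrow> nat" where
  "position Sigma = 0"
| "position (Rho a) = Suc a"

definition vertices :: "nat \<Rightarrow> vertex set" where
  "vertices n = insert Sigma (Rho ` {0..n})"

definition K :: "nat \<Rightarrow> vertex pair_pre_digraph" where
  "K n = \<lparr>pverts = vertices n,
          parcs = {(v, w). v \<in> vertices n \<and> w \<in> vertices n \<and> position v < position w}\<rparr>"

text \<open>Only the labels of arcs of \<open>K n\<close> and of loops \<open>(v, v)\<close> are relevant.\<close>
fun label :: "nat \<Rightarrow> vertex \<times> vertex \<Rightarrow> gen mpoly_m2 set" where
  "label n (Sigma, Sigma) = \<one>\<^bsub>A n\<^esub>"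
| "label n (Sigma, Rho a) = tau n a"
| "label n (Rho a, Sigma) = undefined"
| "label n (Rho a, Rho b) =
     (if a = b then \<one>\<^bsub>A n\<^esub> else xi n (b - a) [^]\<^bsub>A n\<^esub> (2 ^ a :: nat))"

text \<open>Paths are lists of arcs in the order of traversal; \<open>K n\<close> itself has no loops.\<close>
definition length2_paths :: "nat \<Rightarrow> vertex \<Rightarrow> vertex \<Rightarrow> (vertex \<times> vertex) list set" where
  "length2_paths n v z =
     {p. pre_digraph.apath (with_proj (K n)) v p z \<and> length p = 2} \<union>
     (if (v, z) \<in> parcs (K n) then {[(v, v), (v, z)], [(v, z), (z, z)]} else {})"

definition path_sum :: "nat \<Rightarrow> vertex \<Rightarrow> vertex \<Rightarrow>
    ((gen mpoly_m2 set \<times> gen mpoly_m2 set) \<Rightarrow>\<^sub>0 int) set" where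
  "path_sum n v z =
     (\<Oplus>\<^bsub>AA n\<^esub>p\<in>length2_paths n v z. label n (p ! 1) \<otimes>\<otimes>\<^bsub>n\<^esub> label n (p ! 0))"

end

theory Submission
  imports Defs
begin

text \<open>
  A path of length two from \<open>v\<close> to \<open>z\<close>, degenerate or not, is determined by its midpoint \<open>w\<close>
  with \<open>v \<le> w \<le> z\<close>. For \<open>v = \<sigma>\<close> the sum over midpoints is the formula for \<open>\<psi>(\<tau>\<^sub>i)\<close>,
  the midpoint \<open>\<sigma>\<close> giving \<open>\<tau>\<^sub>i \<otimes> 1\<close>. For \<open>v = 2\<^sup>j \<rho>\<close> the midpoint \<open>2\<^bsup>j+k\<^esup> \<rho>\<close> gives the
  \<open>2\<^sup>j\<close>-th power of the \<open>k\<close>-th summand of \<open>\<psi>(\<xi>\<^sub>i)\<close>, and since the tensor product has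
  characteristic two, the Frobenius map turns the power of the sum into the sum of the powers.
\<close>

section \<open>Frobenius in characteristic two\<close>

lemma (in cring) char_two_add_self:
  assumes "\<one> \<oplus> \<one> = \<zero>" "x \<in> carrier R"
  shows "x \<oplus> x = \<zero>"
  using assms l_distr[of \<one> \<one> x] by simp

text \<open>Induction on \<open>j\<close>, one squaring at a time: in \<open>(u \<oplus> v)\<close>
  squared the cross terms form \<open>u \<otimes> v \<oplus> u \<otimes> v\<close>, which vanishes
  in characteristic two.\<close>

lemma (in cring) char_two_add_pow:
  assumes "\<one> \<oplus> \<one> = \<zero>" "x \<in> carrier R" "y \<in> carrier R"
  shows "(x \<oplus> y) [^] (2 ^ j :: nat) = x [^] (2 ^ j :: nat) \<oplus> y [^] (2 ^ j :: nat)"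
proof (induction j)
  case (Suc j)
  have sq: "z [^] (2 ^ Suc j :: nat) = z [^] (2 ^ j :: nat) \<otimes> z [^] (2 ^ j :: nat)"
    if "z \<in> carrier R" for z
    using that by (simp add: nat_pow_mult mult_2)
  define u v where "u = x [^] (2 ^ j :: nat)" and "v = y [^] (2 ^ j :: nat)"
  have carr: "u \<in> carrier R" "v \<in> carrier R"
    using assms by (simp_all add: u_def v_def)
  have "(u \<oplus> v) \<otimes> (u \<oplus> v) = u \<otimes> u \<oplus> v \<otimes> v \<oplus> (u \<otimes> v \<oplus> u \<otimes> v)"
    using carr by algebra
  also have "\<dots> = u \<otimes> u \<oplus> v \<otimes> v"
    using carr by (simp add: char_two_add_self[OF assms(1)])
  finally show ?case
    using assms Suc.IH by (simp add: sq u_def v_def del: power_Suc)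
qed (use assms in simp)

lemma (in cring) char_two_finsum_pow:
  assumes "\<one> \<oplus> \<one> = \<zero>" "finite I" "f \<in> I \<rightarrow> carrier R"
  shows "(\<Oplus>i\<in>I. f i) [^] (2 ^ j :: nat) = (\<Oplus>i\<in>I. f i [^] (2 ^ j :: nat))"
  using assms(2,3)
proof (induction I rule: finite_induct)
  case empty
  \<comment> \<open>The empty sum is zero, and it stays zero because the exponent
    \<open>2 ^ j\<close> is nonzero.\<close>
  then show ?case by (simp add: nat_pow_zero)
next
  case (insert i I)
  then show ?case by (simp add: char_two_add_pow[OF assms(1)] Pi_def)
qed

section \<open>Tensor products\<close>

lemma tensor_base_simps [simp]:
  "carrier (tensor_base R S) = {p. Poly_Mapping.keys p \<subseteq> carrier R \<times> carrier S}"
  "\<one>\<^bsub>tensor_base R S\<^esub> = frag_of (\<one>\<^bsub>R\<^esub>, \<one>\<^bsub>S\<^esub>)"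
  "\<zero>\<^bsub>tensor_base R S\<^esub> = 0"
  "p \<oplus>\<^bsub>tensor_base R S\<^esub> q = p + q"
  by (simp_all add: tensor_base_def)

lemma tensor_base_mult_of:
  "frag_of (x, y) \<otimes>\<^bsub>tensor_base R S\<^esub> frag_of (x', y') = frag_of (x \<otimes>\<^bsub>R\<^esub> x', y \<otimes>\<^bsub>S\<^esub> y')"
  by (simp add: tensor_base_def)

lemma tensor_base_mult_0 [simp]:
  "0 \<otimes>\<^bsub>tensor_base R S\<^esub> q = 0" "p \<otimes>\<^bsub>tensor_base R S\<^esub> 0 = 0"
  by (simp_all add: tensor_base_def frag_extend_eq_0 case_prod_unfold)

lemma tensor_base_mult_diff_left:
  "(p - p') \<otimes>\<^bsub>tensor_base R S\<^esub> q = p \<otimes>\<^bsub>tensor_base R S\<^esub> q - p' \<otimes>\<^bsub>tensor_base R S\<^esub> q"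
  by (simp add: tensor_base_def frag_extend_diff)

text \<open>In \<open>tensor_base\<close> the right factor of a product sits inside the function
  that is extended over the left factor, so additivity on the right comes from linearity of
  \<open>frag_extend\<close> in its function argument.\<close>

lemma frag_extend_diff_fun:
  fixes f g :: "'a \<Rightarrow> 'b \<Rightarrow>\<^sub>0 int"
  shows "frag_extend (\<lambda>x. f x - g x) p = frag_extend f p - frag_extend g p"
proof -
  have "frag_cmul c (a - b) = frag_cmul c a - frag_cmul c b" for c and a b :: "'b \<Rightarrow>\<^sub>0 int"
    by (rule poly_mapping_eqI) (simp add: lookup_minus right_diff_distrib)
  then show ?thesis by (simp add: frag_extend_def sum_subtractf)
qed

lemma tensor_base_mult_diff_right:
  "p \<otimes>\<^bsub>tensor_base R S\<^esub> (q - q') = p \<otimes>\<^bsub>tensor_base R S\<^esub> q - p \<otimes>\<^bsub>tensor_base R S\<^esub> q'"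
  by (simp add: tensor_base_def frag_extend_diff case_prod_unfold frag_extend_diff_fun)

lemma tensor_base_mult_add:
  "(p + p') \<otimes>\<^bsub>tensor_base R S\<^esub> q = p \<otimes>\<^bsub>tensor_base R S\<^esub> q + p' \<otimes>\<^bsub>tensor_base R S\<^esub> q"
  by (simp add: tensor_base_def frag_extend_add)

text \<open>Closure, commutativity, associativity and the unit law are checked on basis elements
  \<open>frag_of (x, y)\<close>, where they hold coordinatewise in \<open>R\<close> and
  \<open>S\<close>. They pass to all elements by \<open>frag_induction\<close>, since multiplication
  respects differences in each argument. Distributivity is built into the linear extension.\<close>

lemma tensor_base_cring:
  assumes "cring R" "cring S"
  shows "cring (tensor_base R S)"
proof -
  interpret R: cring R by fact
  interpret S: cring S by fact
  let ?T = "tensor_base R S"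
  have closed: "Poly_Mapping.keys (p \<otimes>\<^bsub>?T\<^esub> q) \<subseteq> carrier R \<times> carrier S"
    if "Poly_Mapping.keys p \<subseteq> carrier R \<times> carrier S" "Poly_Mapping.keys q \<subseteq> carrier R \<times> carrier S" for p q
    using that(1)
  proof (induction p rule: frag_induction)
    case (one s)
    show ?case using that(2)
    proof (induction q rule: frag_induction)
      case (one t)
      then show ?case using \<open>s \<in> _\<close> by (cases s; cases t) (simp add: tensor_base_mult_of)
    next
      case (diff a b)
      then show ?case
        using keys_diff[of "frag_of s \<otimes>\<^bsub>?T\<^esub> a" "frag_of s \<otimes>\<^bsub>?T\<^esub> b"] by (auto simp: tensor_base_mult_diff_right)
    qed simp
  next
    case (diff a b)
    then show ?case
      using keys_diff[of "a \<otimes>\<^bsub>?T\<^esub> q" "b \<otimes>\<^bsub>?T\<^esub> q"] by (auto simp: tensor_base_mult_diff_left)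
  qed simp
  have comm: "p \<otimes>\<^bsub>?T\<^esub> q = q \<otimes>\<^bsub>?T\<^esub> p"
    if "Poly_Mapping.keys p \<subseteq> carrier R \<times> carrier S" "Poly_Mapping.keys q \<subseteq> carrier R \<times> carrier S" for p q
    using that(1)
  proof (induction p rule: frag_induction)
    case (one s)
    show ?case using that(2)
    proof (induction q rule: frag_induction)
      case (one t)
      then show ?case using \<open>s \<in> _\<close>
        by (cases s; cases t) (simp add: tensor_base_mult_of R.m_comm S.m_comm)
    qed (simp_all add: tensor_base_mult_diff_left tensor_base_mult_diff_right)
  qed (simp_all add: tensor_base_mult_diff_left tensor_base_mult_diff_right)
  have assoc: "p \<otimes>\<^bsub>?T\<^esub> q \<otimes>\<^bsub>?T\<^esub> r = p \<otimes>\<^bsub>?T\<^esub> (q \<otimes>\<^bsub>?T\<^esub> r)"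
    if "Poly_Mapping.keys p \<subseteq> carrier R \<times> carrier S" "Poly_Mapping.keys q \<subseteq> carrier R \<times> carrier S"
      "Poly_Mapping.keys r \<subseteq> carrier R \<times> carrier S" for p q r
    using that(1)
  proof (induction p rule: frag_induction)
    case (one s)
    show ?case using that(2)
    proof (induction q rule: frag_induction)
      case (one t)
      show ?case using that(3)
      proof (induction r rule: frag_induction)
        case (one u)
        then show ?case using \<open>s \<in> _\<close> \<open>t \<in> _\<close>
          by (cases s; cases t; cases u) (simp add: tensor_base_mult_of R.m_assoc S.m_assoc)
      qed (simp_all add: tensor_base_mult_diff_left tensor_base_mult_diff_right)
    qed (simp_all add: tensor_base_mult_diff_left tensor_base_mult_diff_right)
  qed (simp_all add: tensor_base_mult_diff_left tensor_base_mult_diff_right)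
  have one: "frag_of (\<one>\<^bsub>R\<^esub>, \<one>\<^bsub>S\<^esub>) \<otimes>\<^bsub>?T\<^esub> p = p"
    if "Poly_Mapping.keys p \<subseteq> carrier R \<times> carrier S" for p
    using that
  proof (induction p rule: frag_induction)
    case (one s)
    then show ?case by (cases s) (simp add: tensor_base_mult_of)
  qed (simp_all add: tensor_base_mult_diff_right)
  show ?thesis
  proof (rule cringI)
    show "abelian_group ?T"
    proof (rule abelian_groupI)
      fix p assume "p \<in> carrier ?T"
      then show "\<exists>q\<in>carrier ?T. q \<oplus>\<^bsub>?T\<^esub> p = \<zero>\<^bsub>?T\<^esub>"
        by (intro bexI[of _ "- p"]) simp_all
    next
      fix p q assume "p \<in> carrier ?T" "q \<in> carrier ?T"
      then show "p \<oplus>\<^bsub>?T\<^esub> q \<in> carrier ?T"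
        using keys_add[of p q] by auto
    qed (simp_all add: add.assoc add.commute)
    show "Group.comm_monoid ?T"
      by (rule comm_monoidI; unfold tensor_base_simps mem_Collect_eq)
        (erule (1) closed | erule (2) assoc | erule (1) comm | erule one | simp)+
  qed (simp add: tensor_base_mult_add)
qed

section \<open>The quotient by the tensor relations and its pure tensors\<close>

locale tensor_product = R: cring R + S: cring S
  for f :: "'m \<Rightarrow> 'a" and g :: "'m \<Rightarrow> 'b" and R :: "'a ring" and S :: "'b ring" +
  assumes f_closed: "f m \<in> carrier R" and g_closed: "g m \<in> carrier S"
begin

definition pure :: "'a \<Rightarrow> 'b \<Rightarrow> (('a \<times> 'b) \<Rightarrow>\<^sub>0 int) set"
  where "pure x y = tensor_ideal f g R S +>\<^bsub>tensor_base R S\<^esub> frag_of (x, y)"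

text \<open>The balancing relators contain the values \<open>f m\<close> and \<open>g m\<close>; the
  closure assumptions of the locale keep these relators in the carrier, so that the generated ideal
  really is an ideal.\<close>

lemma relators_closed: "tensor_relators f g R S \<subseteq> carrier (tensor_base R S)"
proof -
  interpret T: cring "tensor_base R S"
    by (rule tensor_base_cring) unfold_locales
  have fr: "frag_of (x, y) \<in> carrier (tensor_base R S)" if "x \<in> carrier R" "y \<in> carrier S" for x y
    using that by simp
  have diff: "p - q \<in> carrier (tensor_base R S)"
    if "p \<in> carrier (tensor_base R S)" "q \<in> carrier (tensor_base R S)" for p q
    using that keys_diff[of p q] by auto
  have add: "p + q \<in> carrier (tensor_base R S)"
    if "p \<in> carrier (tensor_base R S)" "q \<in> carrier (tensor_base R S)" for p q
    using T.a_closed[OF that] by simp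
  show ?thesis
    unfolding tensor_relators_def
    by (auto simp del: tensor_base_simps intro!: fr diff add f_closed g_closed)
qed

lemma tensor_ideal_ideal: "ideal (tensor_ideal f g R S) (tensor_base R S)"
  unfolding tensor_ideal_def
  by (intro ring.genideal_ideal cring.axioms(1) tensor_base_cring relators_closed) unfold_locales

text \<open>With the coset map as a homomorphism of commutative rings, products, powers and the unit
  of pure tensors are read off from basis elements.\<close>

sublocale quotient: ring_hom_cring "tensor_base R S" "tensor_ring f g R S"
  "(+>\<^bsub>tensor_base R S\<^esub>) (tensor_ideal f g R S)"
  unfolding tensor_ring_def
  by (rule ideal.rcos_ring_hom_cring[OF tensor_ideal_ideal], rule tensor_base_cring) unfold_locales

lemma tensor_ring_cring: "cring (tensor_ring f g R S)"
  by (rule quotient.S.is_cring)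

lemma pure_closed [simp]:
  "x \<in> carrier R \<Longrightarrow> y \<in> carrier S \<Longrightarrow> pure x y \<in> carrier (tensor_ring f g R S)"
  unfolding pure_def by (rule quotient.hom_closed) simp

lemma pure_mult:
  assumes "x \<in> carrier R" "y \<in> carrier S" "x' \<in> carrier R" "y' \<in> carrier S"
  shows "pure x y \<otimes>\<^bsub>tensor_ring f g R S\<^esub> pure x' y' = pure (x \<otimes>\<^bsub>R\<^esub> x') (y \<otimes>\<^bsub>S\<^esub> y')"
  using assms unfolding pure_def
  by (subst quotient.hom_mult[symmetric]) (simp_all add: tensor_base_mult_of)

lemma one_eq_pure: "\<one>\<^bsub>tensor_ring f g R S\<^esub> = pure \<one>\<^bsub>R\<^esub> \<one>\<^bsub>S\<^esub>"
  unfolding pure_def using quotient.hom_one by simp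

lemma pure_pow:
  assumes "x \<in> carrier R" "y \<in> carrier S"
  shows "pure x y [^]\<^bsub>tensor_ring f g R S\<^esub> (k :: nat) = pure (x [^]\<^bsub>R\<^esub> k) (y [^]\<^bsub>S\<^esub> k)"
  using assms by (induction k) (simp_all add: one_eq_pure pure_mult)

text \<open>The difference of the two representatives is one of the generating relators, so their
  cosets agree.\<close>

lemma pure_add_left:
  assumes "x \<in> carrier R" "x' \<in> carrier R" "y \<in> carrier S"
  shows "pure (x \<oplus>\<^bsub>R\<^esub> x') y = pure x y \<oplus>\<^bsub>tensor_ring f g R S\<^esub> pure x' y"
proof -
  let ?T = "tensor_base R S" and ?I = "tensor_ideal f g R S"
  let ?s = "frag_of (x \<oplus>\<^bsub>R\<^esub> x', y)" and ?t = "frag_of (x, y) + frag_of (x', y)"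
  have t: "?t = frag_of (x, y) \<oplus>\<^bsub>?T\<^esub> frag_of (x', y)" by simp
  have carr: "?s \<in> carrier ?T" "?t \<in> carrier ?T"
    using assms quotient.R.a_closed[of "frag_of (x, y)" "frag_of (x', y)"] by simp_all
  have "?s - ?t \<in> ?I"
    unfolding tensor_ideal_def
    by (rule subsetD[OF ring.genideal_self[OF quotient.R.ring_axioms relators_closed]])
      (use assms in \<open>auto simp: tensor_relators_def\<close>)
  \<comment> \<open>Membership is witnessed by \<open>?s = (?s - ?t) + ?t\<close>, whose first
    summand lies in the ideal.\<close>
  then have "?s \<in> ?I +>\<^bsub>?T\<^esub> ?t"
    by (auto simp: a_r_coset_def' intro!: bexI[of _ "?s - ?t"])
  then have "?I +>\<^bsub>?T\<^esub> ?s = ?I +>\<^bsub>?T\<^esub> ?t"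
    using carr(2) additive_subgroup.a_subgroup[OF ideal.axioms(1)[OF tensor_ideal_ideal]]
    by (rule quotient.R.a_repr_independence[symmetric])
  also have "\<dots> = pure x y \<oplus>\<^bsub>tensor_ring f g R S\<^esub> pure x' y"
    unfolding pure_def t by (rule quotient.hom_add) (use assms in simp_all)
  finally show ?thesis by (simp add: pure_def)
qed

text \<open>Additivity at \<open>0 + 0 = 0\<close> makes this element equal to its own double, and
  cancellation leaves zero.\<close>

lemma pure_zero_left:
  assumes "y \<in> carrier S"
  shows "pure \<zero>\<^bsub>R\<^esub> y = \<zero>\<^bsub>tensor_ring f g R S\<^esub>"
proof -
  have "pure \<zero>\<^bsub>R\<^esub> y \<oplus>\<^bsub>tensor_ring f g R S\<^esub> pure \<zero>\<^bsub>R\<^esub> y = pure \<zero>\<^bsub>R\<^esub> y"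
    using pure_add_left[of "\<zero>\<^bsub>R\<^esub>" "\<zero>\<^bsub>R\<^esub>" y, symmetric] assms by simp
  then show ?thesis
    using quotient.S.add.r_cancel_one[OF pure_closed pure_closed] assms by blast
qed

text \<open>The double of \<open>1 \<otimes> 1\<close> is
  \<open>(1 + 1) \<otimes> 1 = 0 \<otimes> 1 = 0\<close>.\<close>

lemma tensor_ring_char_two:
  assumes "\<one>\<^bsub>R\<^esub> \<oplus>\<^bsub>R\<^esub> \<one>\<^bsub>R\<^esub> = \<zero>\<^bsub>R\<^esub>"
  shows "\<one>\<^bsub>tensor_ring f g R S\<^esub> \<oplus>\<^bsub>tensor_ring f g R S\<^esub> \<one>\<^bsub>tensor_ring f g R S\<^esub> = \<zero>\<^bsub>tensor_ring f g R S\<^esub>"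
  using assms pure_add_left[of "\<one>\<^bsub>R\<^esub>" "\<one>\<^bsub>R\<^esub>" "\<one>\<^bsub>S\<^esub>"]
  by (simp add: one_eq_pure pure_zero_left)

end

section \<open>The quotient Hopf algebroid\<close>

lemma gen_poly_ring_simps [simp]:
  "carrier (gen_poly_ring n) = {p. \<forall>m\<in>Poly_Mapping.keys p. Poly_Mapping.keys m \<subseteq> gens n}"
  "\<one>\<^bsub>gen_poly_ring n\<^esub> = 1" "\<zero>\<^bsub>gen_poly_ring n\<^esub> = 0"
  "p \<oplus>\<^bsub>gen_poly_ring n\<^esub> q = p + q" "p \<otimes>\<^bsub>gen_poly_ring n\<^esub> q = p * q"
  by (simp_all add: gen_poly_ring_def ring_of_type_algebra_def)

lemma gen_poly_closed:
  fixes p q :: "gen mpoly_m2"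
  shows gen_poly_0: "0 \<in> carrier (gen_poly_ring n)"
    and gen_poly_1: "1 \<in> carrier (gen_poly_ring n)"
    and gen_poly_Const: "Const c \<in> carrier (gen_poly_ring n)"
    and gen_poly_add: "p \<in> carrier (gen_poly_ring n) \<Longrightarrow> q \<in> carrier (gen_poly_ring n) \<Longrightarrow>
      p + q \<in> carrier (gen_poly_ring n)"
    and gen_poly_diff: "p \<in> carrier (gen_poly_ring n) \<Longrightarrow> q \<in> carrier (gen_poly_ring n) \<Longrightarrow>
      p - q \<in> carrier (gen_poly_ring n)"
    and gen_poly_mult: "p \<in> carrier (gen_poly_ring n) \<Longrightarrow> q \<in> carrier (gen_poly_ring n) \<Longrightarrow>
      p * q \<in> carrier (gen_poly_ring n)"
proof -
  show "0 \<in> carrier (gen_poly_ring n)" "1 \<in> carrier (gen_poly_ring n)" "Const c \<in> carrier (gen_poly_ring n)"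
    by (auto simp: Const_def simp flip: single_one)
  assume p: "p \<in> carrier (gen_poly_ring n)" and q: "q \<in> carrier (gen_poly_ring n)"
  show "p + q \<in> carrier (gen_poly_ring n)" using p q keys_add[of p q] by fastforce
  show "p - q \<in> carrier (gen_poly_ring n)" using p q keys_diff[of p q] by fastforce
  show "p * q \<in> carrier (gen_poly_ring n)"
  proof -
    \<comment> \<open>A monomial of the product is a sum of exponent vectors, one from each factor,
      so its variables occur in one of the two.\<close>
    have "Poly_Mapping.keys m \<subseteq> gens n" if "m \<in> Poly_Mapping.keys (p * q)" for m
    proof -
      obtain a b where "m = a + b" "a \<in> Poly_Mapping.keys p" "b \<in> Poly_Mapping.keys q"
        using \<open>m \<in> _\<close> keys_mult[of p q] by blast
      then show ?thesis using p q keys_add[of a b] by fastforce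
    qed
    then show ?thesis by simp
  qed
qed

lemma gen_poly_pow:
  "p \<in> carrier (gen_poly_ring n) \<Longrightarrow> p ^ k \<in> carrier (gen_poly_ring n)"
  by (induction k) (auto simp del: gen_poly_ring_simps intro: gen_poly_closed)

lemma gen_poly_sum:
  "(\<And>i. i \<in> I \<Longrightarrow> h i \<in> carrier (gen_poly_ring n)) \<Longrightarrow> sum h I \<in> carrier (gen_poly_ring n)"
  by (induction I rule: infinite_finite_induct) (auto simp del: gen_poly_ring_simps intro: gen_poly_closed)

text \<open>The conventions 1 at index 0 and 0 above \<open>n\<close> make every index admissible,
  in particular the index \<open>i + 1 = n + 1\<close> occurring in the last relator.\<close>

lemma gen_poly_xi: "xi_poly n i \<in> carrier (gen_poly_ring n)"
  using gen_poly_0 gen_poly_1 by (auto simp: xi_poly_def Var_def gens_def)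

lemma gen_poly_tau: "tau_poly n i \<in> carrier (gen_poly_ring n)"
  by (auto simp: tau_poly_def Var_def gens_def)

lemmas gen_poly_intros = gen_poly_closed gen_poly_pow gen_poly_sum gen_poly_xi gen_poly_tau

lemma gen_poly_ring_cring: "cring (gen_poly_ring n)"
proof (rule cringI)
  show "abelian_group (gen_poly_ring n)"
  proof (rule abelian_groupI)
    fix p q r assume p: "p \<in> carrier (gen_poly_ring n)" and q: "q \<in> carrier (gen_poly_ring n)"
    show "\<exists>q\<in>carrier (gen_poly_ring n). q \<oplus>\<^bsub>gen_poly_ring n\<^esub> p = \<zero>\<^bsub>gen_poly_ring n\<^esub>"
      \<comment> \<open>The additive inverse is taken in the form \<open>0 - p\<close>, to which
        closure under differences applies.\<close>
      by (rule bexI[OF _ gen_poly_diff[OF gen_poly_0 p]]) (simp only: gen_poly_ring_simps diff_0 left_minus)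
    show "p \<oplus>\<^bsub>gen_poly_ring n\<^esub> q \<in> carrier (gen_poly_ring n)"
      by (simp only: gen_poly_ring_simps(4) gen_poly_add p q)
    show "p \<oplus>\<^bsub>gen_poly_ring n\<^esub> q \<oplus>\<^bsub>gen_poly_ring n\<^esub> r = p \<oplus>\<^bsub>gen_poly_ring n\<^esub> (q \<oplus>\<^bsub>gen_poly_ring n\<^esub> r)"
      by (simp only: gen_poly_ring_simps add.assoc)
    show "p \<oplus>\<^bsub>gen_poly_ring n\<^esub> q = q \<oplus>\<^bsub>gen_poly_ring n\<^esub> p"
      by (simp only: gen_poly_ring_simps add.commute)
    show "\<zero>\<^bsub>gen_poly_ring n\<^esub> \<oplus>\<^bsub>gen_poly_ring n\<^esub> p = p"
      by (simp only: gen_poly_ring_simps add_0)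
  qed (simp only: gen_poly_ring_simps(3) gen_poly_0)
  show "Group.comm_monoid (gen_poly_ring n)"
  proof (rule comm_monoidI)
    fix p q r assume p: "p \<in> carrier (gen_poly_ring n)" and q: "q \<in> carrier (gen_poly_ring n)"
    show "p \<otimes>\<^bsub>gen_poly_ring n\<^esub> q \<in> carrier (gen_poly_ring n)"
      by (simp only: gen_poly_ring_simps(5) gen_poly_mult p q)
    show "p \<otimes>\<^bsub>gen_poly_ring n\<^esub> q \<otimes>\<^bsub>gen_poly_ring n\<^esub> r = p \<otimes>\<^bsub>gen_poly_ring n\<^esub> (q \<otimes>\<^bsub>gen_poly_ring n\<^esub> r)"
      by (simp only: gen_poly_ring_simps mult.assoc)
    show "p \<otimes>\<^bsub>gen_poly_ring n\<^esub> q = q \<otimes>\<^bsub>gen_poly_ring n\<^esub> p"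
      by (simp only: gen_poly_ring_simps mult.commute)
    show "\<one>\<^bsub>gen_poly_ring n\<^esub> \<otimes>\<^bsub>gen_poly_ring n\<^esub> p = p"
      by (simp only: gen_poly_ring_simps mult_1_left)
  qed (simp only: gen_poly_ring_simps(2) gen_poly_1)
qed (simp only: gen_poly_ring_simps distrib_right)

section \<open>The quotient algebra and its characteristic\<close>

lemma relators_subset: "relators n \<subseteq> carrier (gen_poly_ring n)"
  unfolding relators_def by (auto simp del: gen_poly_ring_simps intro!: gen_poly_intros)

lemma rel_ideal_ideal: "ideal (rel_ideal n) (gen_poly_ring n)"
  unfolding rel_ideal_def
  by (intro ring.genideal_ideal cring.axioms(1) gen_poly_ring_cring relators_subset)

lemma cls_ring_hom_cring: "ring_hom_cring (gen_poly_ring n) (A n) (cls n)"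
  using ideal.rcos_ring_hom_cring[OF rel_ideal_ideal gen_poly_ring_cring, of n]
  by (simp add: A_def cls_def[abs_def])

lemma cls_closed: "p \<in> carrier (gen_poly_ring n) \<Longrightarrow> cls n p \<in> carrier (A n)"
  by (rule ring_hom_closed[OF ring_hom_cring.homh[OF cls_ring_hom_cring]])

lemma A_cring: "cring (A n)"
  using ring_hom_cring.axioms(2)[OF cls_ring_hom_cring] .

lemma xi_closed [simp]: "xi n i \<in> carrier (A n)"
  unfolding xi_def by (intro cls_closed gen_poly_xi)

lemma tau_closed [simp]: "tau n i \<in> carrier (A n)"
  unfolding tau_def by (intro cls_closed gen_poly_tau)

lemma xi_0: "xi n 0 = \<one>\<^bsub>A n\<^esub>"
  using ring_hom_one[OF ring_hom_cring.homh[OF cls_ring_hom_cring], of n] by (simp add: xi_def xi_poly_def)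

text \<open>The identity \<open>1 + 1 = 0\<close> climbs from \<open>bit\<close> to polynomials over
  it, to \<open>m2\<close>, to polynomials over \<open>m2\<close>, and then passes along the class
  map.\<close>

lemma A_char_two: "\<one>\<^bsub>A n\<^esub> \<oplus>\<^bsub>A n\<^esub> \<one>\<^bsub>A n\<^esub> = \<zero>\<^bsub>A n\<^esub>"
proof -
  interpret ring_hom_cring "gen_poly_ring n" "A n" "cls n"
    by (rule cls_ring_hom_cring)
  have "(1 :: (nat \<times> nat) \<Rightarrow>\<^sub>0 bit) + 1 = 0"
    by (simp flip: single_one single_add)
  then have "(1 :: m2) + 1 = 0"
    by (simp add: one_m2_def plus_m2_def zero_m2_def)
  then have "(1 :: gen mpoly_m2) + 1 = 0"
    by (simp flip: single_one single_add)
  then show ?thesis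
    using hom_add[OF R.one_closed R.one_closed] hom_one hom_zero by simp
qed

section \<open>The tensor square over the coefficient ring\<close>

lemma A_tensor_product: "tensor_product (right_unit n) (left_unit n) (A n) (A n)"
proof (intro tensor_product.intro tensor_product_axioms.intro A_cring)
  fix m
  show "right_unit n m \<in> carrier (A n)"
    unfolding right_unit_def right_unit_poly_def case_prod_unfold
    by (intro cls_closed gen_poly_intros)
  show "left_unit n m \<in> carrier (A n)"
    unfolding left_unit_def by (intro cls_closed gen_poly_intros)
qed

lemma pure_eq_tensor:
  "tensor_product.pure (right_unit n) (left_unit n) (A n) (A n) x y = x \<otimes>\<otimes>\<^bsub>n\<^esub> y"
  by (simp add: tensor_product.pure_def[OF A_tensor_product] tensor_def)

lemma AA_cring: "cring (AA n)"
  unfolding AA_def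
  by (rule tensor_product.tensor_ring_cring[OF A_tensor_product])

lemma AA_char_two: "\<one>\<^bsub>AA n\<^esub> \<oplus>\<^bsub>AA n\<^esub> \<one>\<^bsub>AA n\<^esub> = \<zero>\<^bsub>AA n\<^esub>"
  using tensor_product.tensor_ring_char_two[OF A_tensor_product A_char_two]
  by (simp add: AA_def)

lemma tensor_closed:
  "x \<in> carrier (A n) \<Longrightarrow> y \<in> carrier (A n) \<Longrightarrow> x \<otimes>\<otimes>\<^bsub>n\<^esub> y \<in> carrier (AA n)"
  using tensor_product.pure_closed[OF A_tensor_product] by (simp add: pure_eq_tensor AA_def)

text \<open>Thanks to this, each summand of the coproduct is still a single tensor after the
  Frobenius map.\<close>

lemma tensor_pow:
  "x \<in> carrier (A n) \<Longrightarrow> y \<in> carrier (A n) \<Longrightarrow>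
    (x \<otimes>\<otimes>\<^bsub>n\<^esub> y) [^]\<^bsub>AA n\<^esub> (k :: nat) = (x [^]\<^bsub>A n\<^esub> k) \<otimes>\<otimes>\<^bsub>n\<^esub> (y [^]\<^bsub>A n\<^esub> k)"
  using tensor_product.pure_pow[OF A_tensor_product] by (simp add: pure_eq_tensor AA_def)

section \<open>Paths of length two\<close>

text \<open>Injectivity turns a weak inequality of positions into the alternative of a loop or a
  strict increase.\<close>

lemma position_inject [simp]: "position v = position w \<longleftrightarrow> v = w"
  by (cases v; cases w) auto

text \<open>The two degenerate paths are the cases \<open>w = v\<close> and \<open>w = z\<close> of the midpoint.\<close>
lemma length2_paths_eq:
  assumes "(v, z) \<in> parcs (K n)"
  shows "length2_paths n v z =
    (\<lambda>w. [(v, w), (w, z)]) ` {w \<in> vertices n. position v \<le> position w \<and> position w \<le> position z}"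
    (is "_ = ?P ` ?W")
proof -
  have "pre_digraph.apath (with_proj (K n)) v p z \<and> length p = 2 \<longleftrightarrow>
      (\<exists>w\<in>vertices n. position v < position w \<and> position w < position z \<and> p = ?P w)" for p
  proof (cases "length p = 2")
    case True
    then obtain a b c d where p: "p = [(a, b), (c, d)]"
      by (auto simp: numeral_2_eq_2 length_Suc_conv)
    \<comment> \<open>The two arcs of a walk share their middle vertex. Distinctness of the three
      vertices, demanded by \<open>apath\<close>, follows from strictly increasing
      positions.\<close>
    show ?thesis using assms
      by (auto simp: p pre_digraph.apath_def pre_digraph.awalk_def pre_digraph.cas.simps
          pre_digraph.awalk_verts.simps K_def)
  qed auto
  then have "length2_paths n v z =
      ?P ` {w \<in> vertices n. position v < position w \<and> position w < position z} \<union> {?P v, ?P z}"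
    using assms by (auto simp: length2_paths_def)
  also have "\<dots> = ?P ` ?W"
    using assms unfolding K_def by (auto simp: le_less)
  finally show ?thesis .
qed

text \<open>The hypothesis admits loops and upward pairs only; it excludes
  \<open>(Rho a, Sigma)\<close>, whose label is \<open>undefined\<close>.\<close>

lemma label_closed:
  assumes "v = w \<or> position v < position w"
  shows "label n (v, w) \<in> carrier (A n)"
proof -
  interpret A: cring "A n" by (rule A_cring)
  show ?thesis using assms by (cases v; cases w) auto
qed

text \<open>Loops fit the formula for edges: for \<open>a = b\<close> it gives a power of
  \<open>xi n 0\<close>, which is the unit.\<close>

lemma label_Rho:
  assumes "a \<le> b"
  shows "label n (Rho a, Rho b) = xi n (b - a) [^]\<^bsub>A n\<^esub> (2 ^ a :: nat)"
proof -
  interpret A: cring "A n" by (rule A_cring)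
  show ?thesis using assms by (auto simp: xi_0)
qed

text \<open>Different midpoints give different paths, so the sum over paths can be reindexed by
  midpoints.\<close>

lemma path_sum_eq:
  assumes "(v, z) \<in> parcs (K n)"
  shows "path_sum n v z =
    (\<Oplus>\<^bsub>AA n\<^esub>w\<in>{w \<in> vertices n. position v \<le> position w \<and> position w \<le> position z}.
       label n (w, z) \<otimes>\<otimes>\<^bsub>n\<^esub> label n (v, w))"
proof -
  interpret AA: cring "AA n" by (rule AA_cring)
  have "inj_on (\<lambda>w. [(v, w), (w, z)]) W" for W
    by (auto intro: inj_onI)
  then show ?thesis
    unfolding path_sum_def length2_paths_eq[OF assms]
    by (subst AA.finsum_reindex)
      (auto simp: le_less intro!: tensor_closed label_closed)
qed

text \<open>The midpoint is written \<open>Rho (k + j)\<close>. The second edge has index difference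
  \<open>(i + j) - (k + j) = i - k\<close> and starts at \<open>Rho (k + j)\<close>, whence the
  exponent \<open>2 ^ (j + k)\<close>; the first has difference \<open>k\<close> and exponent
  \<open>2 ^ j\<close>. The ends \<open>k = 0\<close> and \<open>k = i\<close> are the degenerate
  paths.\<close>

lemma path_sum_Rho:
  assumes "1 \<le> i" "i + j \<le> n"
  shows "path_sum n (Rho j) (Rho (i + j)) =
    (\<Oplus>\<^bsub>AA n\<^esub>k\<in>{0..i}. (xi n (i - k) [^]\<^bsub>A n\<^esub> (2 ^ (j + k) :: nat)) \<otimes>\<otimes>\<^bsub>n\<^esub> (xi n k [^]\<^bsub>A n\<^esub> (2 ^ j :: nat)))"
proof -
  interpret A: cring "A n" by (rule A_cring)
  interpret AA: cring "AA n" by (rule AA_cring)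
  have arc: "(Rho j, Rho (i + j)) \<in> parcs (K n)"
    using assms by (auto simp: K_def vertices_def)
  \<comment> \<open>\<open>Sigma\<close> drops out because its position 0 is below
    \<open>Suc j\<close>, and \<open>i + j \<le> n\<close> makes every \<open>Rho a\<close> in the
    range a vertex.\<close>
  have "{w \<in> vertices n. position (Rho j) \<le> position w \<and> position w \<le> position (Rho (i + j))}
      = Rho ` {j..i + j}"
    using assms by (auto simp: vertices_def)
  also have "{j..i + j} = (\<lambda>k. k + j) ` {0..i}"
    by simp
  finally have W: "{w \<in> vertices n. position (Rho j) \<le> position w \<and> position w \<le> position (Rho (i + j))}
      = (\<lambda>k. Rho (k + j)) ` {0..i}"
    by (simp only: image_image)
  have "path_sum n (Rho j) (Rho (i + j)) =
      (\<Oplus>\<^bsub>AA n\<^esub>k\<in>{0..i}. label n (Rho (k + j), Rho (i + j)) \<otimes>\<otimes>\<^bsub>n\<^esub> label n (Rho j, Rho (k + j)))"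
    unfolding path_sum_eq[OF arc] W
    by (subst AA.finsum_reindex)
      (auto simp: inj_on_def le_less simp del: label.simps intro!: tensor_closed label_closed)
  also have "\<dots> = (\<Oplus>\<^bsub>AA n\<^esub>k\<in>{0..i}.
      (xi n (i - k) [^]\<^bsub>A n\<^esub> (2 ^ (j + k) :: nat)) \<otimes>\<otimes>\<^bsub>n\<^esub> (xi n k [^]\<^bsub>A n\<^esub> (2 ^ j :: nat)))"
    by (rule AA.finsum_cong')
      (auto simp: label_Rho add.commute simp del: label.simps intro!: tensor_closed)
  finally show ?thesis .
qed

text \<open>The midpoint \<open>Sigma\<close> is split off as the extra summand, its loop being the
  right-hand factor 1. In the remaining sum, \<open>k = i\<close> is the loop at the target and
  contributes \<open>1 \<otimes> \<tau>_i\<close>.\<close>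

lemma path_sum_Sigma:
  assumes "i \<le> n"
  shows "path_sum n Sigma (Rho i) = (tau n i \<otimes>\<otimes>\<^bsub>n\<^esub> \<one>\<^bsub>A n\<^esub>) \<oplus>\<^bsub>AA n\<^esub>
    (\<Oplus>\<^bsub>AA n\<^esub>k\<in>{0..i}. (xi n (i - k) [^]\<^bsub>A n\<^esub> (2 ^ k :: nat)) \<otimes>\<otimes>\<^bsub>n\<^esub> tau n k)"
proof -
  interpret A: cring "A n" by (rule A_cring)
  interpret AA: cring "AA n" by (rule AA_cring)
  have arc: "(Sigma, Rho i) \<in> parcs (K n)"
    using assms by (auto simp: K_def vertices_def)
  have W: "{w \<in> vertices n. position Sigma \<le> position w \<and> position w \<le> position (Rho i)}
      = insert Sigma (Rho ` {0..i})"
    using assms by (auto simp: vertices_def)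
  have "path_sum n Sigma (Rho i) = (tau n i \<otimes>\<otimes>\<^bsub>n\<^esub> \<one>\<^bsub>A n\<^esub>) \<oplus>\<^bsub>AA n\<^esub>
      (\<Oplus>\<^bsub>AA n\<^esub>w\<in>Rho ` {0..i}. label n (w, Rho i) \<otimes>\<otimes>\<^bsub>n\<^esub> label n (Sigma, w))"
    unfolding path_sum_eq[OF arc] W
    by (subst AA.finsum_insert) (auto simp: label_Rho simp del: label.simps(4) intro!: tensor_closed)
  also have "(\<Oplus>\<^bsub>AA n\<^esub>w\<in>Rho ` {0..i}. label n (w, Rho i) \<otimes>\<otimes>\<^bsub>n\<^esub> label n (Sigma, w)) =
      (\<Oplus>\<^bsub>AA n\<^esub>k\<in>{0..i}. label n (Rho k, Rho i) \<otimes>\<otimes>\<^bsub>n\<^esub> label n (Sigma, Rho k))"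
    by (rule AA.finsum_reindex)
      (auto simp: inj_on_def le_less simp del: label.simps intro!: tensor_closed label_closed)
  also have "\<dots> = (\<Oplus>\<^bsub>AA n\<^esub>k\<in>{0..i}. (xi n (i - k) [^]\<^bsub>A n\<^esub> (2 ^ k :: nat)) \<otimes>\<otimes>\<^bsub>n\<^esub> tau n k)"
    by (rule AA.finsum_cong')
      (auto simp: label_Rho simp del: label.simps(4) intro!: tensor_closed)
  finally show ?thesis .
qed

theorem theorem4p12:
  fixes n :: nat
  assumes "is_coproduct n \<psi>"
  shows "(\<forall>i j. 1 \<le> i \<and> i + j \<le> n \<longrightarrow>
            \<psi> (xi n i [^]\<^bsub>A n\<^esub> (2 ^ j :: nat)) = path_sum n (Rho j) (Rho (i + j)))
       \<and> (\<forall>i. i \<le> n \<longrightarrow> \<psi> (tau n i) = path_sum n Sigma (Rho i))"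
proof (intro conjI allI impI)
  fix i j assume ij: "1 \<le> i \<and> i + j \<le> n"
  interpret A: cring "A n" by (rule A_cring)
  interpret AA: cring "AA n" by (rule AA_cring)
  interpret \<psi>: ring_hom_ring "A n" "AA n" \<psi>
    using assms by (intro ring_hom_ringI2 A.ring_axioms AA.ring_axioms)
      (simp add: is_coproduct_def)
  have "\<psi> (xi n i [^]\<^bsub>A n\<^esub> (2 ^ j :: nat)) = \<psi> (xi n i) [^]\<^bsub>AA n\<^esub> (2 ^ j :: nat)"
    by (simp add: \<psi>.hom_nat_pow)
  \<comment> \<open>The coproduct formula applies because \<open>1 \<le> i\<close> and
    \<open>i + j \<le> n\<close> place \<open>i\<close> in \<open>{1..n}\<close>.\<close>
  also have "\<dots> = (\<Oplus>\<^bsub>AA n\<^esub>k\<in>{0..i}. (xi n (i - k) [^]\<^bsub>A n\<^esub> (2 ^ k :: nat)) \<otimes>\<otimes>\<^bsub>n\<^esub> xi n k)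
      [^]\<^bsub>AA n\<^esub> (2 ^ j :: nat)"
    using assms ij by (simp add: is_coproduct_def)
  also have "\<dots> = (\<Oplus>\<^bsub>AA n\<^esub>k\<in>{0..i}.
      ((xi n (i - k) [^]\<^bsub>A n\<^esub> (2 ^ k :: nat)) \<otimes>\<otimes>\<^bsub>n\<^esub> xi n k) [^]\<^bsub>AA n\<^esub> (2 ^ j :: nat))"
    by (rule AA.char_two_finsum_pow)
      (auto intro!: AA_char_two tensor_closed)
  also have "\<dots> = path_sum n (Rho j) (Rho (i + j))"
    \<comment> \<open>Factorwise powers give the exponent \<open>2 ^ k * 2 ^ j = 2 ^ (j + k)\<close>
      on the left, which is the label of the second edge.\<close>
    unfolding path_sum_Rho[OF conjunct1[OF ij] conjunct2[OF ij]]
    by (rule AA.finsum_cong')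
      (auto simp: tensor_pow A.nat_pow_pow power_add mult.commute intro!: tensor_closed)
  finally show "\<psi> (xi n i [^]\<^bsub>A n\<^esub> (2 ^ j :: nat)) = path_sum n (Rho j) (Rho (i + j))" .
next
  fix i assume "i \<le> n"
  \<comment> \<open>No Frobenius map enters here: \<open>path_sum_Sigma\<close> already has the form
    of the coproduct formula.\<close>
  then show "\<psi> (tau n i) = path_sum n Sigma (Rho i)"
    using assms by (simp add: is_coproduct_def path_sum_Sigma)
qed

end
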